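(* Let $Y=\{1,2,3\}$ be the cycle set given by the permutations $\varphi_1=\varphi_2=\operatorname{id}$, $\varphi_3=(1\,2)$ (where $\varphi_x(y)=x\cdot y$), let $S=\{a,b\}$ be a set with two elements, and let $$\mathcal A=\{(1,2,a),(1,2,b),(1,3,b),(2,1,a),(2,1,b),(2,3,b)\}\subseteq Y\times Y\times S.$$ Let $\alpha\colon Y\times Y\times S\to\operatorname{Sym}(S)$ be the map with $\alpha_{x,y}(s,-)=(a\,b)$ if $(x,y,s)\in\mathcal A$ and $\alpha_{x,y}(s,-)=\operatorname{id}$ otherwise. Then $\alpha$ is a dynamical cocycle of $Y$ with values on $S$. Writing $x_j=(a,j)$ for $j\in\{1,2,3\}$ and $x_j=(b,j-3)$ for $j\in\{4,5,6\}$, the dynamical extension $X=S\times_\alpha Y$ is the cycle set $\{x_1,\dots,x_6\}$ whose permutations $\psi_x\colon y\mapsto x\cdot y$ are $$\psi_{x_1}=(x_2x_5),\quad \psi_{x_2}=(x_1x_4),\quad \psi_{x_3}=(x_1x_2)(x_4x_5),$$ $$\psi_{x_4}=(x_2x_5)(x_3x_6),\quad \psi_{x_5}=(x_1x_4)(x_3x_6),\quad \psi_{x_6}=(x_1x_2)(x_4x_5).$$ This cycle set corresponds to a square-free multipermutation solution of level four, so that $\operatorname{mpl}X=4>\log_2 6=\log_2|X|$. In particular $\mathbf n_4\le 6<2^3+1$, where $\mathbf n_m$ denotes the minimal integer such that there exists a square-free multipermutation solution of size $\mathbf n_m$ and level $m$.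
   Context: A cycle set is a set $X$ with a binary operation $(x,y)\mapsto x\cdot y$ such that for each $x\in X$ the map $y\mapsto x\cdot y$ is bijective and $(x\cdot y)\cdot(x\cdot z)=(y\cdot x)\cdot(y\cdot z)$ for all $x,y,z\in X$. Let $Y$ be a finite cycle set, $S$ a finite nonempty set, and $\operatorname{Sym}(S)$ the set of permutations of $S$. A dynamical cocycle of $Y$ with values on $S$ is a map $\alpha\colon Y\times Y\times S\to \operatorname{Sym}(S)$, $(x,y,s)\mapsto\alpha_{x,y}(s,-)$ (where $\alpha_{x,y}(s,-)$ denotes the map $t\mapsto\alpha_{x,y}(s,t)$), such that $$\alpha_{x\cdot y,x\cdot z}(\alpha_{x,y}(r,s),\alpha_{x,z}(r,t))=\alpha_{y\cdot x,y\cdot z}(\alpha_{y,x}(s,r),\alpha_{y,z}(s,t))$$ for all $x,y,z\in Y$, $r,s,t\in S$. The dynamical extension $S\times_\alpha Y$ is the set $S\times Y$ with the operation $(s,x)\cdot(t,y)=(\alpha_{x,y}(s,t),x\cdot y)$. A solution means a finite nondegenerate involutive set-theoretic solution of the Yang--Baxter equation: a pair $(X,r)$ with $X$ a finite nonempty set and $r\colon X\times X\to X\times X$ bijective, $r(x,y)=(\sigma_x(y),\tau_y(x))$, such that $r_{12}r_{23}r_{12}=r_{23}r_{12}r_{23}$ (where $r_{12}=r\times\operatorname{id}$, $r_{23}=\operatorname{id}\times r$), $r^2=\operatorname{id}$, and all $\sigma_x,\tau_x$ are bijective. It is square-free if $r(x,x)=(x,x)$ for all $x\in X$. Finite cycle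 sets correspond bijectively to solutions via $r(x,y)=((y*x)\cdot y,\,y*x)$, where $y*x=z$ if and only if $x=y\cdot z$. The retract relation on a solution $(X,r)$ is $x\sim y$ if and only if $\sigma_x=\sigma_y$, and the retraction $\operatorname{Ret}(X,r)$ is the solution on $X/{\sim}$ given by $\overline r([x],[y])=([\sigma_x(y)],[\tau_y(x)])$. Iterated retractions are $\operatorname{Ret}^1=\operatorname{Ret}$ and $\operatorname{Ret}^k(X,r)=\operatorname{Ret}(\operatorname{Ret}^{k-1}(X,r))$ for $k>1$. $(X,r)$ is a multipermutation solution if there is $m>0$ such that $\operatorname{Ret}^m(X,r)$ has cardinality one; its level $\operatorname{mpl}X$ is the least such $m$. *)

theory Defs
  imports Complex_Main "HOL-Library.FSet" "HOL-Combinatorics.Permutations"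
begin

definition cycle_set :: "'a set \<Rightarrow> ('a \<Rightarrow> 'a \<Rightarrow> 'a) \<Rightarrow> bool" where
  "cycle_set X m \<longleftrightarrow>
     (\<forall>x\<in>X. bij_betw (m x) X X) \<and>
     (\<forall>x\<in>X. \<forall>y\<in>X. \<forall>z\<in>X. m (m x y) (m x z) = m (m y x) (m y z))"

definition dynamical_cocycle ::
    "'y set \<Rightarrow> ('y \<Rightarrow> 'y \<Rightarrow> 'y) \<Rightarrow> 's set \<Rightarrow> ('y \<Rightarrow> 'y \<Rightarrow> 's \<Rightarrow> 's \<Rightarrow> 's) \<Rightarrow> bool" where
  "dynamical_cocycle Y m S \<alpha> \<longleftrightarrow>
     finite Y \<and> cycle_set Y m \<and> finite S \<and> S \<noteq> {} \<and>
     (\<forall>x\<in>Y. \<forall>y\<in>Y. \<forall>s\<in>S. \<alpha> x y s permutes S) \<and>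
     (\<forall>x\<in>Y. \<forall>y\<in>Y. \<forall>z\<in>Y. \<forall>r\<in>S. \<forall>s\<in>S. \<forall>t\<in>S.
        \<alpha> (m x y) (m x z) (\<alpha> x y r s) (\<alpha> x z r t) =
        \<alpha> (m y x) (m y z) (\<alpha> y x s r) (\<alpha> y z s t))"

text \<open>The dynamical extension has carrier \<open>S \<times> Y\<close> and the following operation.\<close>

definition ext_op ::
    "('y \<Rightarrow> 'y \<Rightarrow> 'y) \<Rightarrow> ('y \<Rightarrow> 'y \<Rightarrow> 's \<Rightarrow> 's \<Rightarrow> 's) \<Rightarrow> 's \<times> 'y \<Rightarrow> 's \<times> 'y \<Rightarrow> 's \<times> 'y" where
  "ext_op m \<alpha> = (\<lambda>(s, x) (t, y). (\<alpha> x y s t, m x y))"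

type_synonym 'a ybe_pair = "'a set \<times> ('a \<times> 'a \<Rightarrow> 'a \<times> 'a)"

definition sigma :: "('a \<times> 'a \<Rightarrow> 'a \<times> 'a) \<Rightarrow> 'a \<Rightarrow> 'a \<Rightarrow> 'a" where
  "sigma r x y = fst (r (x, y))"

definition tau :: "('a \<times> 'a \<Rightarrow> 'a \<times> 'a) \<Rightarrow> 'a \<Rightarrow> 'a \<Rightarrow> 'a" where
  "tau r y x = snd (r (x, y))"

definition r12 :: "('a \<times> 'a \<Rightarrow> 'a \<times> 'a) \<Rightarrow> 'a \<times> 'a \<times> 'a \<Rightarrow> 'a \<times> 'a \<times> 'a" where
  "r12 r = (\<lambda>(x, y, z). case r (x, y) of (u, v) \<Rightarrow> (u, v, z))"

definition r23 :: "('a \<times> 'a \<Rightarrow> 'a \<times> 'a) \<Rightarrow> 'a \<times> 'a \<times> 'a \<Rightarrow> 'a \<times> 'a \<times> 'a" where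
  "r23 r = (\<lambda>(x, y, z). (x, r (y, z)))"

fun solution :: "'a ybe_pair \<Rightarrow> bool" where
  "solution (X, r) \<longleftrightarrow>
     finite X \<and> X \<noteq> {} \<and> bij_betw r (X \<times> X) (X \<times> X) \<and>
     (\<forall>t \<in> X \<times> X \<times> X. r12 r (r23 r (r12 r t)) = r23 r (r12 r (r23 r t))) \<and>
     (\<forall>p \<in> X \<times> X. r (r p) = p) \<and>
     (\<forall>x\<in>X. bij_betw (sigma r x) X X) \<and>
     (\<forall>x\<in>X. bij_betw (tau r x) X X)"

fun square_free :: "'a ybe_pair \<Rightarrow> bool" where
  "square_free (X, r) \<longleftrightarrow> (\<forall>x\<in>X. r (x, x) = (x, x))"

text \<open>The operation \<open>y * x = z \<longleftrightarrow> x = m y z\<close> on the cycle set \<open>X\<close>, and the solution it gives.\<close>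

definition left_div :: "'a set \<Rightarrow> ('a \<Rightarrow> 'a \<Rightarrow> 'a) \<Rightarrow> 'a \<Rightarrow> 'a \<Rightarrow> 'a" where
  "left_div X m y x = (THE z. z \<in> X \<and> x = m y z)"

definition solution_of_cycle_set :: "'a set \<Rightarrow> ('a \<Rightarrow> 'a \<Rightarrow> 'a) \<Rightarrow> 'a ybe_pair" where
  "solution_of_cycle_set X m =
     (X, \<lambda>(x, y). (m (left_div X m y x) y, left_div X m y x))"

fun retract_rel :: "'a ybe_pair \<Rightarrow> 'a rel" where
  "retract_rel (X, r) = {(x, y). x \<in> X \<and> y \<in> X \<and> (\<forall>z\<in>X. sigma r x z = sigma r y z)}"

text \<open>For a solution, the image below is a singleton whenever \<open>C\<close> and \<open>D\<close> are classes;
  its only element is the value of the induced map on \<open>(C, D)\<close>.\<close>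

fun Ret :: "'a ybe_pair \<Rightarrow> 'a set ybe_pair" where
  "Ret (X, r) =
     (X // retract_rel (X, r),
      \<lambda>(C, D). the_elem ((\<lambda>(x, y). (retract_rel (X, r) `` {sigma r x y},
                                     retract_rel (X, r) `` {tau r y x})) ` (C \<times> D)))"

text \<open>Each application of \<open>Ret\<close> changes the carrier type from \<open>'a\<close> to \<open>'a set\<close>. To iterate it, the
  classes are viewed in a type closed under the formation of finite sets, along the maps \<open>Elem\<close> and
  \<open>Class \<circ> Abs_fset\<close>, which are injective on finite carriers and on their finite classes.\<close>

datatype 'a iter_class = Elem 'a | Class "'a iter_class fset"

fun transport :: "('a \<Rightarrow> 'b) \<Rightarrow> 'a ybe_pair \<Rightarrow> 'b ybe_pair" where
  "transport f (X, r) =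
     (f ` X, \<lambda>(u, v). map_prod f f (r (inv_into X f u, inv_into X f v)))"

definition Ret_iter :: "nat \<Rightarrow> 'a ybe_pair \<Rightarrow> 'a iter_class ybe_pair" where
  "Ret_iter k P = ((\<lambda>Q. transport (Class \<circ> Abs_fset) (Ret Q)) ^^ k) (transport Elem P)"

definition multipermutation :: "'a ybe_pair \<Rightarrow> bool" where
  "multipermutation P \<longleftrightarrow> solution P \<and> (\<exists>m>0. card (fst (Ret_iter m P)) = 1)"

definition mpl :: "'a ybe_pair \<Rightarrow> nat" where
  "mpl P = (LEAST m. m > 0 \<and> card (fst (Ret_iter m P)) = 1)"

text \<open>Solutions are finite, so up to isomorphism their carriers are subsets of \<open>\<nat>\<close>.
  The minimum is meaningful only if a solution of level \<open>m\<close> exists.\<close>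

definition min_size :: "nat \<Rightarrow> nat" where
  "min_size m = (LEAST n. \<exists>P :: nat ybe_pair.
     square_free P \<and> multipermutation P \<and> mpl P = m \<and> card (fst P) = n)"

end

theory Submission
  imports Defs
begin

text \<open>
  The proof replaces the dynamical extension by its multiplication table on the labels
  \<open>1, \<dots>, 6\<close>, and uses two special features of that table: every \<open>\<psi>\<^sub>x\<close> is an involution, and
  the cyclic condition \<open>(x \<cdot> y) \<cdot> x = y \<cdot> x\<close> holds. Together they turn the associated solution into
  \<open>r(x, y) = (x \<cdot> y, y \<cdot> x)\<close>, so that \<open>\<sigma>\<^sub>x = \<tau>\<^sub>x = \<psi>\<^sub>x\<close>; the Yang--Baxter equation is then a short
  formal consequence of the cycle set identity (lemma \<open>solution\<close> of the locale below).

  Since \<open>\<sigma>\<^sub>x = \<psi>\<^sub>x\<close>, retracting means identifying elements with the same row in the table. In terms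
  of labels, the tower of iterated retractions is a tower of partitions
  \<open>1|2|3|4|5|6\<close>, \<open>1|2|36|4|5\<close>, \<open>14|25|36\<close>, \<open>1245|36\<close>, \<open>123456\<close>,
  where each partition is determined by the previous one: two labels are joined when their rows agree
  up to the previous partition. Its sizes \<open>6, 5, 3, 2, 1\<close> give level four. Lemma
  \<open>labels_retract\<close> performs one retraction on this level of labels, without ever
  looking at the nested classes themselves, and \<open>labels_Ret_iter\<close> iterates it.

  Everything is proved for an arbitrary injectively labelled copy of the table. One copy is the
  dynamical extension; the table itself, on natural numbers, is the copy that bounds \<open>min_size 4\<close>. The cocycle
  identity needs no separate computation: it is the first component of the cycle set identity in
  \<open>S \<times>\<^sub>\<alpha> Y\<close>.
\<close>

section \<open>Involutive cycle sets satisfying the cyclic condition\<close>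

locale involutive_cycle_set =
  fixes X :: "'a set" and m :: "'a \<Rightarrow> 'a \<Rightarrow> 'a"
  assumes fin: "finite X" and ne: "X \<noteq> {}"
    and closed: "x \<in> X \<Longrightarrow> y \<in> X \<Longrightarrow> m x y \<in> X"
    and invol: "x \<in> X \<Longrightarrow> y \<in> X \<Longrightarrow> m x (m x y) = y"
    and cyclic: "x \<in> X \<Longrightarrow> y \<in> X \<Longrightarrow> m (m x y) x = m y x"
    and cycle: "x \<in> X \<Longrightarrow> y \<in> X \<Longrightarrow> z \<in> X \<Longrightarrow> m (m x y) (m x z) = m (m y x) (m y z)"
begin

lemma bij: "x \<in> X \<Longrightarrow> bij_betw (m x) X X"
  by (rule bij_betw_byWitness[where f' = "m x"]) (auto simp: invol closed)

lemma cycle_set: "cycle_set X m"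
  using bij cycle by (simp add: cycle_set_def)

lemma left_div: "x \<in> X \<Longrightarrow> y \<in> X \<Longrightarrow> left_div X m y x = m y x"
  unfolding left_div_def by (rule the_equality) (auto simp: invol closed)

text \<open>The first component of the solution is \<open>(y \<cdot> x) \<cdot> y\<close>, which the cyclic condition collapses
  to \<open>x \<cdot> y\<close>.\<close>

lemma solution_apply:
  "x \<in> X \<Longrightarrow> y \<in> X \<Longrightarrow> snd (solution_of_cycle_set X m) (x, y) = (m x y, m y x)"
  by (simp add: solution_of_cycle_set_def left_div cyclic)

text \<open>The first component of the braid relation; by symmetry in the outer two arguments it is the
  last one as well. It is the cycle set identity at \<open>m y z\<close> in place of \<open>z\<close>,
  with one involution moved across.\<close>

lemma exchange: "x \<in> X \<Longrightarrow> y \<in> X \<Longrightarrow> z \<in> X \<Longrightarrow> m (m x y) (m (m y x) z) = m x (m y z)"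
  using cycle[of x y "m y z"] invol[of "m x y" "m x (m y z)"] by (simp add: invol closed)

text \<open>The middle component. Writing \<open>x\<close> and \<open>z\<close> as images under \<open>m y\<close> makes the claim symmetric:
  both sides reduce to the two sides of the cycle set identity for \<open>y \<cdot> v\<close>, \<open>w\<close> and \<open>y\<close>.\<close>

lemma braid_middle:
  assumes "x \<in> X" "y \<in> X" "z \<in> X"
  shows "m (m (m y x) z) (m x y) = m (m (m y z) x) (m z y)"
proof -
  define v w where "v = m y x" and "w = m y z"
  have X: "v \<in> X" "w \<in> X" and xz: "x = m y v" "z = m y w"
    using assms by (simp_all add: v_def w_def closed invol)
  have "m (m v (m y w)) (m v y) = m (m (m v y) (m (m y v) w)) (m v y)"
    using X assms by (simp add: exchange)
  also have "\<dots> = m (m (m y v) w) (m v y)"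
    using X assms by (simp add: cyclic closed)
  also have "\<dots> = m (m (m y v) w) (m (m y v) y)"
    using X assms by (simp add: cyclic)
  also have "\<dots> = m (m w (m y v)) (m w y)"
    using X assms by (intro cycle) (simp_all add: closed)
  finally have "m (m v (m y w)) (m v y) = m (m w (m y v)) (m w y)" .
  moreover have "m (m y v) y = m v y" "m (m y w) y = m w y"
    using X assms by (simp_all add: cyclic)
  ultimately show ?thesis
    using xz by (metis v_def w_def)
qed

lemma solution: "solution (solution_of_cycle_set X m)"
proof -
  obtain r where P: "solution_of_cycle_set X m = (X, r)"
    by (simp add: solution_of_cycle_set_def)
  have r: "r (x, y) = (m x y, m y x)" if "x \<in> X" "y \<in> X" for x y
    using solution_apply[OF that] by (simp add: P)
  have "m (m x y) (m y x) = x" if "x \<in> X" "y \<in> X" for x y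
    using that cyclic[of x y] invol[of "m x y" x] closed by metis
  then have inv: "r (r (x, y)) = (x, y)" if "x \<in> X" "y \<in> X" for x y
    using that by (simp add: r closed)
  have "bij_betw r (X \<times> X) (X \<times> X)"
    by (rule bij_betw_byWitness[where f' = r]) (auto simp: inv, auto simp: r closed)
  moreover have "r12 r (r23 r (r12 r (x, y, z))) = r23 r (r12 r (r23 r (x, y, z)))"
    if "x \<in> X" "y \<in> X" "z \<in> X" for x y z
    using that by (simp add: r12_def r23_def r closed exchange braid_middle)
  moreover have "bij_betw (sigma r x) X X" "bij_betw (tau r x) X X" if "x \<in> X" for x
    using bij[OF that] that by (simp_all add: sigma_def tau_def r cong: bij_betw_cong)
  ultimately show ?thesis
    using fin ne inv by (auto simp: P)
qed

end

section \<open>Retractions of labelled pairs\<close>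

text \<open>The labelling \<open>g\<close> need not be injective: after some retractions, labels in the same class name
  the same element. Keeping one label set for the whole tower reduces the study of iterated classes
  to the study of the kernels of the labellings.\<close>

definition labels :: "'i set \<Rightarrow> ('i \<Rightarrow> 'i \<Rightarrow> 'i) \<Rightarrow> ('i \<Rightarrow> 'a) \<Rightarrow> 'a ybe_pair \<Rightarrow> bool" where
  "labels I p g P \<longleftrightarrow> fst P = g ` I \<and>
     (\<forall>i\<in>I. \<forall>j\<in>I. snd P (g i, g j) = (g (p i j), g (p j i)))"

text \<open>\<open>Abs_fset\<close> is unspecified on infinite sets, hence the finiteness assumptions.\<close>

lemma Class_inj:
  assumes "finite C" "finite D" "(Class \<circ> Abs_fset) C = (Class \<circ> Abs_fset) D"
  shows "C = D"
  using assms by (simp add: Abs_fset_inject)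

lemma labels_transport_Elem:
  assumes "labels I p g P"
  shows "labels I p (Elem \<circ> g) (transport Elem P)"
proof -
  obtain X r where P: "P = (X, r)" by force
  have "inv_into X Elem (Elem u) = u" if "u \<in> X" for u
    using that by (simp add: inj_on_def)
  then show ?thesis
    using assms by (auto simp: labels_def P)
qed

text \<open>One retraction step. The function \<open>c\<close> prescribes the kernel of the new labelling: \<open>kernel\<close> says
  that \<open>c\<close> joins exactly the labels related by the retract relation. That this relation is compatible
  with the solution, so that \<open>the_elem\<close> in the definition of the retraction is applied to a
  singleton, is the content of \<open>cong\<close>.\<close>

lemma labels_retract:
  fixes Q :: "'a iter_class ybe_pair" and c :: "'i \<Rightarrow> 'k"
  assumes Q: "labels I p g Q" and I: "finite I"
    and closed: "\<And>i j. i \<in> I \<Longrightarrow> j \<in> I \<Longrightarrow> p i j \<in> I"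
    and kernel: "\<And>i j. i \<in> I \<Longrightarrow> j \<in> I \<Longrightarrow> c i = c j \<longleftrightarrow> (\<forall>l\<in>I. g (p i l) = g (p j l))"
    and cong: "\<And>i j i' j'. i \<in> I \<Longrightarrow> j \<in> I \<Longrightarrow> i' \<in> I \<Longrightarrow> j' \<in> I \<Longrightarrow>
      c i = c i' \<Longrightarrow> c j = c j' \<Longrightarrow> c (p i j) = c (p i' j')"
  shows "\<exists>g'. labels I p g' (transport (Class \<circ> Abs_fset) (Ret Q)) \<and>
    (\<forall>i\<in>I. \<forall>j\<in>I. g' i = g' j \<longleftrightarrow> c i = c j)"
proof -
  obtain Z r where Zr: "Q = (Z, r)" by force
  define R where "R = retract_rel (Z, r)"
  define F where "F = (Class \<circ> Abs_fset :: 'a iter_class set \<Rightarrow> 'a iter_class)"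
  define h where "h i = R `` {g i}" for i
  have Z: "Z = g ` I" using Q by (simp add: labels_def Zr)
  have r: "r (g i, g j) = (g (p i j), g (p j i))" if "i \<in> I" "j \<in> I" for i j
    using Q that by (simp add: labels_def Zr)
  have R: "(g i, g j) \<in> R \<longleftrightarrow> c i = c j" if "i \<in> I" "j \<in> I" for i j
    using that kernel[OF that] by (auto simp: R_def Z sigma_def r)
  have h: "h i = g ` {j \<in> I. c j = c i}" if "i \<in> I" for i
  proof -
    have "h i \<subseteq> Z" by (auto simp: h_def R_def)
    then show ?thesis using that R by (fastforce simp: h_def Z)
  qed
  have h_eq: "h i = h j \<longleftrightarrow> c i = c j" if "i \<in> I" "j \<in> I" for i j
  proof
    assume "h i = h j"
    moreover have "g j \<in> h j" using that by (simp add: h)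
    ultimately have "(g i, g j) \<in> R" unfolding h_def by blast
    then show "c i = c j" using that R by blast
  qed (use that in \<open>simp add: h\<close>)
  have quot: "Z // R = h ` I"
    by (auto simp: quotient_def h_def Z)
  have F_eq: "F (h i) = F (h j) \<longleftrightarrow> h i = h j" if "i \<in> I" "j \<in> I" for i j
  proof -
    have "finite (h i)" "finite (h j)" using that I by (simp_all add: h)
    then show ?thesis
      unfolding F_def by (intro iffI, elim Class_inj[rotated 2]) simp_all
  qed
  have inj: "inj_on F (Z // R)"
    using F_eq by (auto simp: inj_on_def quot)
  have inv: "inv_into (Z // R) F (F (h i)) = h i" if "i \<in> I" for i
    using that by (intro inv_into_f_f inj) (simp add: quot)
  have the: "the_elem ((\<lambda>(x, y). (R `` {sigma r x y}, R `` {tau r y x})) ` (h i \<times> h j))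
      = (h (p i j), h (p j i))" if ij: "i \<in> I" "j \<in> I" for i j
  proof -
    have "(R `` {sigma r x y}, R `` {tau r y x}) = (h (p i j), h (p j i))"
      if xy: "x \<in> h i" "y \<in> h j" for x y
    proof -
      obtain i' where i': "i' \<in> I" "x = g i'" "c i' = c i"
        using xy(1) unfolding h[OF ij(1)] image_iff Bex_def mem_Collect_eq by blast
      obtain j' where j': "j' \<in> I" "y = g j'" "c j' = c j"
        using xy(2) unfolding h[OF ij(2)] image_iff Bex_def mem_Collect_eq by blast
      have "c (p i' j') = c (p i j)" by (rule cong) (use ij i' j' in simp_all)
      moreover have "c (p j' i') = c (p j i)" by (rule cong) (use ij i' j' in simp_all)
      ultimately have "h (p i' j') = h (p i j)" "h (p j' i') = h (p j i)"
        using ij i' j' by (simp_all add: h_eq closed)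
      then show ?thesis
        using i' j' by (simp add: sigma_def tau_def r h_def)
    qed
    then have "(\<lambda>(x, y). (R `` {sigma r x y}, R `` {tau r y x})) ` (h i \<times> h j)
        = (\<lambda>_. (h (p i j), h (p j i))) ` (h i \<times> h j)"
      by (intro image_cong refl) (simp only: mem_Times_iff split_beta)
    also have "\<dots> = {(h (p i j), h (p j i))}"
    proof -
      have "(g i, g j) \<in> h i \<times> h j" using ij by (simp add: h)
      then show ?thesis by (metis empty_iff image_constant_conv)
    qed
    finally show ?thesis by (simp only: the_elem_eq)
  qed
  have "Ret Q = (h ` I, \<lambda>(C, D). the_elem
      ((\<lambda>(x, y). (R `` {sigma r x y}, R `` {tau r y x})) ` (C \<times> D)))"
    unfolding Zr Ret.simps R_def[symmetric] quot ..
  then have "labels I p (F \<circ> h) (transport F (Ret Q))"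
    by (simp add: labels_def image_comp inv[unfolded quot] the)
  moreover have "\<forall>i\<in>I. \<forall>j\<in>I. (F \<circ> h) i = (F \<circ> h) j \<longleftrightarrow> c i = c j"
    by (simp add: F_eq h_eq)
  ultimately show ?thesis unfolding F_def by blast
qed

section \<open>The cycle set of size six\<close>

definition I6 :: "nat set" where "I6 = {1, 2, 3, 4, 5, 6}"

definition op6 :: "nat \<Rightarrow> nat \<Rightarrow> nat" where
  "op6 i = (if i = 1 then transpose 2 5 else if i = 2 then transpose 1 4
     else if i = 4 then transpose 2 5 \<circ> transpose 3 6
     else if i = 5 then transpose 1 4 \<circ> transpose 3 6
     else transpose 1 2 \<circ> transpose 4 5)"

text \<open>Rewriting with this equivalence and with the multiplication table turns each statement
  about all labels into finitely many equations between numerals.\<close>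

lemma all_I6: "(\<forall>i\<in>I6. Q i) \<longleftrightarrow> Q 1 \<and> Q 2 \<and> Q 3 \<and> Q 4 \<and> Q 5 \<and> Q 6"
  by (simp add: I6_def)

lemma I6_mem: "1 \<in> I6" "2 \<in> I6" "3 \<in> I6" "4 \<in> I6" "5 \<in> I6" "6 \<in> I6"
  by (simp_all add: I6_def)

lemma op6_table:
  "op6 1 1 = 1" "op6 1 2 = 5" "op6 1 3 = 3" "op6 1 4 = 4" "op6 1 5 = 2" "op6 1 6 = 6"
  "op6 2 1 = 4" "op6 2 2 = 2" "op6 2 3 = 3" "op6 2 4 = 1" "op6 2 5 = 5" "op6 2 6 = 6"
  "op6 3 1 = 2" "op6 3 2 = 1" "op6 3 3 = 3" "op6 3 4 = 5" "op6 3 5 = 4" "op6 3 6 = 6"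
  "op6 4 1 = 1" "op6 4 2 = 5" "op6 4 3 = 6" "op6 4 4 = 4" "op6 4 5 = 2" "op6 4 6 = 3"
  "op6 5 1 = 4" "op6 5 2 = 2" "op6 5 3 = 6" "op6 5 4 = 1" "op6 5 5 = 5" "op6 5 6 = 3"
  "op6 6 1 = 2" "op6 6 2 = 1" "op6 6 3 = 3" "op6 6 4 = 5" "op6 6 5 = 4" "op6 6 6 = 6"
  by (simp_all add: op6_def transpose_def)

lemma op6_closed: "\<forall>i\<in>I6. \<forall>j\<in>I6. op6 i j \<in> I6"
  by (simp only: all_I6 op6_table I6_mem simp_thms)

interpretation six: involutive_cycle_set I6 op6
proof
  have "\<forall>x\<in>I6. \<forall>y\<in>I6. op6 x (op6 x y) = y" by (simp only: all_I6 op6_table simp_thms)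
  then show "x \<in> I6 \<Longrightarrow> y \<in> I6 \<Longrightarrow> op6 x (op6 x y) = y" for x y by blast
  have "\<forall>x\<in>I6. \<forall>y\<in>I6. op6 (op6 x y) x = op6 y x" by (simp only: all_I6 op6_table simp_thms)
  then show "x \<in> I6 \<Longrightarrow> y \<in> I6 \<Longrightarrow> op6 (op6 x y) x = op6 y x" for x y by blast
  have "\<forall>x\<in>I6. \<forall>y\<in>I6. \<forall>z\<in>I6. op6 (op6 x y) (op6 x z) = op6 (op6 y x) (op6 y z)"
    by (simp only: all_I6 op6_table simp_thms)
  then show "x \<in> I6 \<Longrightarrow> y \<in> I6 \<Longrightarrow> z \<in> I6 \<Longrightarrow> op6 (op6 x y) (op6 x z) = op6 (op6 y x) (op6 y z)" for x y z
    by blast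
  show "x \<in> I6 \<Longrightarrow> y \<in> I6 \<Longrightarrow> op6 x y \<in> I6" for x y
    using op6_closed by blast
qed (simp_all add: I6_def)

text \<open>\<open>cls k i\<close> is the least label that names the same class as \<open>i\<close> after \<open>k \<le> 4\<close> retractions.\<close>

definition cls :: "nat \<Rightarrow> nat \<Rightarrow> nat" where
  "cls k i = (if k = 0 then i
     else if k = 1 then (if i = 6 then 3 else i)
     else if k = 2 then (if i > 3 then i - 3 else i)
     else if k = 3 then (if i = 3 \<or> i = 6 then 3 else 1)
     else 1)"

lemma cls_table:
  "cls 0 1 = 1" "cls 0 2 = 2" "cls 0 3 = 3" "cls 0 4 = 4" "cls 0 5 = 5" "cls 0 6 = 6"
  "cls 1 1 = 1" "cls 1 2 = 2" "cls 1 3 = 3" "cls 1 4 = 4" "cls 1 5 = 5" "cls 1 6 = 3"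
  "cls 2 1 = 1" "cls 2 2 = 2" "cls 2 3 = 3" "cls 2 4 = 1" "cls 2 5 = 2" "cls 2 6 = 3"
  "cls 3 1 = 1" "cls 3 2 = 1" "cls 3 3 = 3" "cls 3 4 = 1" "cls 3 5 = 1" "cls 3 6 = 3"
  "cls 4 1 = 1" "cls 4 2 = 1" "cls 4 3 = 1" "cls 4 4 = 1" "cls 4 5 = 1" "cls 4 6 = 1"
  by (simp_all add: cls_def)

lemma cls_kernel:
  assumes "k < 4"
  shows "\<forall>i\<in>I6. \<forall>j\<in>I6. cls (Suc k) i = cls (Suc k) j \<longleftrightarrow> (\<forall>l\<in>I6. cls k (op6 i l) = cls k (op6 j l))"
proof -
  have Suc: "Suc 0 = 1" "Suc 1 = 2" "Suc 2 = 3" "Suc 3 = 4" by simp_all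
  consider "k = 0" | "k = 1" | "k = 2" | "k = 3" using assms by linarith
  then show ?thesis
    by (cases; hypsubst, unfold Suc; unfold all_I6 op6_table cls_table; simp)
qed

text \<open>Each partition is a congruence. Comparing a product with the product of the two representatives
  involves pairs of labels only, whereas comparing two arbitrary products would involve quadruples.\<close>

lemma cls_quotient:
  assumes "k \<le> 4"
  shows "\<forall>i\<in>I6. \<forall>j\<in>I6. cls k (op6 i j) = cls k (op6 (cls k i) (cls k j))"
proof -
  consider "k = 0" | "k = 1" | "k = 2" | "k = 3" | "k = 4" using assms by linarith
  then show ?thesis by (cases; hypsubst, simp only: all_I6 op6_table cls_table simp_thms)
qed

lemma labels_Ret_iter:
  assumes P: "labels I6 op6 x P" and inj: "inj_on x I6" and "k \<le> 4"
  shows "\<exists>g. labels I6 op6 g (Ret_iter k P) \<and> (\<forall>i\<in>I6. \<forall>j\<in>I6. g i = g j \<longleftrightarrow> cls k i = cls k j)"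
  using \<open>k \<le> 4\<close>
proof (induction k)
  case 0
  show ?case
    using labels_transport_Elem[OF P] inj
    by (intro exI[of _ "Elem \<circ> x"]) (auto simp: Ret_iter_def cls_def inj_on_eq_iff comp_def)
next
  case (Suc k)
  then obtain g where g: "labels I6 op6 g (Ret_iter k P)"
    and ker: "\<forall>i\<in>I6. \<forall>j\<in>I6. g i = g j \<longleftrightarrow> cls k i = cls k j" by auto
  have "Ret_iter (Suc k) P = transport (Class \<circ> Abs_fset) (Ret (Ret_iter k P))"
    by (simp add: Ret_iter_def)
  moreover have "\<exists>g'. labels I6 op6 g' (transport (Class \<circ> Abs_fset) (Ret (Ret_iter k P))) \<and>
      (\<forall>i\<in>I6. \<forall>j\<in>I6. g' i = g' j \<longleftrightarrow> cls (Suc k) i = cls (Suc k) j)"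
  proof (rule labels_retract[OF g six.fin six.closed])
    fix i j assume "i \<in> I6" "j \<in> I6"
    then show "cls (Suc k) i = cls (Suc k) j \<longleftrightarrow> (\<forall>l\<in>I6. g (op6 i l) = g (op6 j l))"
      using cls_kernel[of k] Suc.prems ker six.closed by simp
  next
    fix i j i' j' assume "i \<in> I6" "j \<in> I6" "i' \<in> I6" "j' \<in> I6"
      "cls (Suc k) i = cls (Suc k) i'" "cls (Suc k) j = cls (Suc k) j'"
    then show "cls (Suc k) (op6 i j) = cls (Suc k) (op6 i' j')"
      using cls_quotient[OF Suc.prems] by metis
  qed
  ultimately show ?case by simp
qed

lemma card_Ret_iter:
  assumes "labels I6 op6 x P" "inj_on x I6" "k \<le> 4"
  shows "card (fst (Ret_iter k P)) = card (cls k ` I6)"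
proof -
  obtain g where g: "fst (Ret_iter k P) = g ` I6"
    and ker: "\<forall>i\<in>I6. \<forall>j\<in>I6. g i = g j \<longleftrightarrow> cls k i = cls k j"
    using labels_Ret_iter[OF assms] by (auto simp: labels_def)
  have "bij_betw (\<lambda>n. g (inv_into I6 (cls k) n)) (cls k ` I6) (g ` I6)"
    unfolding bij_betw_def
  proof
    show "inj_on (\<lambda>n. g (inv_into I6 (cls k) n)) (cls k ` I6)"
      using ker by (intro inj_onI) (metis f_inv_into_f inv_into_into)
    have "g (inv_into I6 (cls k) (cls k i)) = g i" if "i \<in> I6" for i
      using ker that by (metis f_inv_into_f image_eqI inv_into_into)
    then show "(\<lambda>n. g (inv_into I6 (cls k) n)) ` cls k ` I6 = g ` I6"
      by (simp add: image_image)
  qed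
  then show ?thesis using g by (simp add: bij_betw_same_card)
qed

lemma copy_of_six:
  fixes x :: "nat \<Rightarrow> 'a"
  assumes inj: "inj_on x I6" and X: "X = x ` I6"
    and m: "\<And>i j. i \<in> I6 \<Longrightarrow> j \<in> I6 \<Longrightarrow> m (x i) (x j) = x (op6 i j)"
  defines "P \<equiv> solution_of_cycle_set X m"
  shows "cycle_set X m" "solution P" "square_free P" "multipermutation P" "mpl P = 4"
proof -
  interpret involutive_cycle_set X m
    by unfold_locales
      (auto simp: X m six.fin six.ne six.closed six.invol six.cyclic six.cycle)
  show "cycle_set X m" by (rule cycle_set)
  show sol: "solution P" unfolding P_def by (rule solution)
  have P: "P = (X, snd P)" by (simp add: P_def solution_of_cycle_set_def)
  have lab: "labels I6 op6 x P"
    unfolding labels_def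
  proof (intro conjI ballI)
    show "fst P = x ` I6" by (simp add: P_def solution_of_cycle_set_def X)
    show "snd P (x i, x j) = (x (op6 i j), x (op6 j i))" if "i \<in> I6" "j \<in> I6" for i j
      using that solution_apply[of "x i" "x j"] by (simp add: P_def X m)
  qed
  have "\<forall>i\<in>I6. op6 i i = i" by (simp only: all_I6 op6_table simp_thms)
  then have "\<forall>y\<in>X. snd P (y, y) = (y, y)"
    using lab X by (auto simp: labels_def)
  then show "square_free P" using P by (metis square_free.simps)
  note card = card_Ret_iter[OF lab inj]
  have four: "card (fst (Ret_iter 4 P)) = 1"
    using card[of 4] by (simp add: I6_def cls_def)
  then show "multipermutation P"
    unfolding multipermutation_def using sol by (metis zero_less_numeral)
  have "card (fst (Ret_iter k P)) \<noteq> 1" if "0 < k" "k < 4" for k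
  proof -
    consider "k = 1" | "k = 2" | "k = 3" using \<open>0 < k\<close> \<open>k < 4\<close> by linarith
    then show ?thesis by cases (simp_all add: card I6_def cls_def)
  qed
  then show "mpl P = 4"
    unfolding mpl_def using four by (intro Least_equality) (auto simp: not_less[symmetric])
qed

lemma min_size_4: "min_size 4 \<le> 6"
proof -
  let ?P = "solution_of_cycle_set I6 op6"
  have "square_free ?P \<and> multipermutation ?P \<and> mpl ?P = 4"
    using copy_of_six[of id I6 op6] by simp
  moreover have "card (fst ?P) = 6"
    by (simp add: solution_of_cycle_set_def I6_def)
  ultimately show ?thesis
    unfolding min_size_def by (intro Least_le exI[of _ ?P]) blast
qed

section \<open>The dynamical extension\<close>

text \<open>The cocycle identity is literally the first component of the cycle set identity of the
  extension.\<close>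

lemma cocycle_of_extension:
  assumes "finite Y" "cycle_set Y m" "finite S" "S \<noteq> {}"
    and perm: "\<And>x y s. x \<in> Y \<Longrightarrow> y \<in> Y \<Longrightarrow> s \<in> S \<Longrightarrow> \<alpha> x y s permutes S"
    and ext: "cycle_set (S \<times> Y) (ext_op m \<alpha>)"
  shows "dynamical_cocycle Y m S \<alpha>"
proof -
  have "\<alpha> (m x y) (m x z) (\<alpha> x y r s) (\<alpha> x z r t) =
        \<alpha> (m y x) (m y z) (\<alpha> y x s r) (\<alpha> y z s t)"
    if "x \<in> Y" "y \<in> Y" "z \<in> Y" "r \<in> S" "s \<in> S" "t \<in> S" for x y z r s t
  proof -
    have "ext_op m \<alpha> (ext_op m \<alpha> (r, x) (s, y)) (ext_op m \<alpha> (r, x) (t, z)) =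
        ext_op m \<alpha> (ext_op m \<alpha> (s, y) (r, x)) (ext_op m \<alpha> (s, y) (t, z))"
      using ext that by (simp add: cycle_set_def)
    then show ?thesis by (simp add: ext_op_def)
  qed
  then show ?thesis
    using assms by (simp add: dynamical_cocycle_def)
qed

theorem mainTheorem3:
  fixes Y :: "nat set" and \<phi> :: "nat \<Rightarrow> nat \<Rightarrow> nat"
    and S :: "'s set" and a b :: 's
    and A :: "(nat \<times> nat \<times> 's) set"
    and \<alpha> :: "nat \<Rightarrow> nat \<Rightarrow> 's \<Rightarrow> 's \<Rightarrow> 's"
    and x :: "nat \<Rightarrow> 's \<times> nat"
    and X :: "('s \<times> nat) set"
    and \<psi> :: "'s \<times> nat \<Rightarrow> 's \<times> nat \<Rightarrow> 's \<times> nat"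
  assumes Y: "Y = {1, 2, 3}"
    and \<phi>: "\<phi> 1 = id" "\<phi> 2 = id" "\<phi> 3 = transpose 1 2"
    and S: "S = {a, b}" "a \<noteq> b"
    and A: "A = {(1, 2, a), (1, 2, b), (1, 3, b), (2, 1, a), (2, 1, b), (2, 3, b)}"
    and \<alpha>: "\<And>p q s. p \<in> Y \<Longrightarrow> q \<in> Y \<Longrightarrow> s \<in> S \<Longrightarrow>
               \<alpha> p q s = (if (p, q, s) \<in> A then transpose a b else id)"
    and x: "\<And>j. j \<in> {1, 2, 3} \<Longrightarrow> x j = (a, j)" "\<And>j. j \<in> {4, 5, 6} \<Longrightarrow> x j = (b, j - 3)"
    and X: "X = S \<times> Y"
    and \<psi>: "\<psi> = ext_op \<phi> \<alpha>"
  shows "cycle_set Y \<phi> \<and>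
    dynamical_cocycle Y \<phi> S \<alpha> \<and>
    cycle_set X \<psi> \<and>
    X = {x 1, x 2, x 3, x 4, x 5, x 6} \<and>
    (\<forall>y\<in>X. \<psi> (x 1) y = transpose (x 2) (x 5) y) \<and>
    (\<forall>y\<in>X. \<psi> (x 2) y = transpose (x 1) (x 4) y) \<and>
    (\<forall>y\<in>X. \<psi> (x 3) y = (transpose (x 1) (x 2) \<circ> transpose (x 4) (x 5)) y) \<and>
    (\<forall>y\<in>X. \<psi> (x 4) y = (transpose (x 2) (x 5) \<circ> transpose (x 3) (x 6)) y) \<and>
    (\<forall>y\<in>X. \<psi> (x 5) y = (transpose (x 1) (x 4) \<circ> transpose (x 3) (x 6)) y) \<and>
    (\<forall>y\<in>X. \<psi> (x 6) y = (transpose (x 1) (x 2) \<circ> transpose (x 4) (x 5)) y) \<and>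
    solution (solution_of_cycle_set X \<psi>) \<and>
    square_free (solution_of_cycle_set X \<psi>) \<and>
    multipermutation (solution_of_cycle_set X \<psi>) \<and>
    mpl (solution_of_cycle_set X \<psi>) = 4 \<and>
    real (mpl (solution_of_cycle_set X \<psi>)) > log 2 6 \<and>
    log 2 6 = log 2 (real (card X)) \<and>
    min_size 4 \<le> 6 \<and>
    (6 :: nat) < 2 ^ 3 + 1"
proof -
  have xs: "x 1 = (a, 1)" "x 2 = (a, 2)" "x 3 = (a, 3)" "x 4 = (b, 1)" "x 5 = (b, 2)" "x 6 = (b, 3)"
    using x(1)[of 1] x(1)[of 2] x(1)[of 3] x(2)[of 4] x(2)[of 5] x(2)[of 6] by simp_all
  have XI: "X = x ` I6"
    unfolding X S Y I6_def image_insert image_empty xs by auto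
  have inj: "inj_on x I6"
    using S(2) by (auto simp: inj_on_def I6_def xs simp del: One_nat_def)
  have mem: "1 \<in> Y" "2 \<in> Y" "3 \<in> Y" "a \<in> S" "b \<in> S"
    by (simp_all add: Y S)
  have \<phi>s: "\<phi> (Suc 0) = id" using \<phi>(1) by simp
  have "\<forall>i\<in>I6. \<forall>j\<in>I6. \<psi> (x i) (x j) = x (op6 i j)"
    unfolding all_I6 op6_table xs \<psi> ext_op_def prod.case
    using S(2) \<alpha>[unfolded Y S(1)] by (simp add: \<phi> \<phi>s A transpose_def)
  then have \<psi>x: "\<psi> (x i) (x j) = x (op6 i j)" if "i \<in> I6" "j \<in> I6" for i j
    using that by blast
  note copy = copy_of_six[OF inj XI \<psi>x]
  have "cycle_set Y \<phi>"
    unfolding cycle_set_def Y using \<phi> \<phi>s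
    by (auto simp: bij_betw_def inj_on_def transpose_def)
  have "dynamical_cocycle Y \<phi> S \<alpha>"
  proof (rule cocycle_of_extension)
    show "\<alpha> y z s permutes S" if "y \<in> Y" "z \<in> Y" "s \<in> S" for y z s
      using \<alpha>[OF that] mem by (simp add: permutes_id permutes_swap_id)
    show "cycle_set (S \<times> Y) (ext_op \<phi> \<alpha>)"
      using copy(1) by (simp add: X \<psi>)
  qed (use \<open>cycle_set Y \<phi>\<close> in \<open>simp_all add: Y S\<close>)
  have "X = {x 1, x 2, x 3, x 4, x 5, x 6}"
    by (simp add: XI I6_def)
  have "card X = 6"
    unfolding XI card_image[OF inj] by (simp add: I6_def)
  have "log 2 6 < (4 :: real)"
    by (simp add: log_less_iff)
  have ball_X: "(\<forall>y\<in>X. Q y) \<longleftrightarrow> (\<forall>j\<in>I6. Q (x j))" for Q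
    by (simp add: XI)
  have rows:
    "\<forall>y\<in>X. \<psi> (x 1) y = transpose (x 2) (x 5) y"
    "\<forall>y\<in>X. \<psi> (x 2) y = transpose (x 1) (x 4) y"
    "\<forall>y\<in>X. \<psi> (x 3) y = (transpose (x 1) (x 2) \<circ> transpose (x 4) (x 5)) y"
    "\<forall>y\<in>X. \<psi> (x 4) y = (transpose (x 2) (x 5) \<circ> transpose (x 3) (x 6)) y"
    "\<forall>y\<in>X. \<psi> (x 5) y = (transpose (x 1) (x 4) \<circ> transpose (x 3) (x 6)) y"
    "\<forall>y\<in>X. \<psi> (x 6) y = (transpose (x 1) (x 2) \<circ> transpose (x 4) (x 5)) y"
    using S(2)
    by (simp_all only: ball_X all_I6 \<psi>x I6_mem op6_table, simp_all only: xs, simp_all add: transpose_def)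
  show ?thesis
    by (intro conjI; (fact | rule copy min_size_4 | simp add: copy(5) \<open>card X = 6\<close> \<open>log 2 6 < 4\<close>))
qed

end
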